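(* For any $1$-Lipschitz function $f:\Omega\to\mathbb{R}$ on $(\Omega,d)$, $$\mathrm{Var}_{\pi}(f)\ \le\ \left(\sum_{k\ge 0}(1-\kappa_k)^2\right)\mathbb{E}_{\pi}\left(\frac{\sigma^2}{n}\right),$$ where the right-hand side is read as $+\infty$ if the series diverges.
   Context: $(\Omega,d)$ is a Polish metric space and $P(x,\mathrm{d}y)$ is a Markov kernel on $\Omega$, measurable in $x$, with stationary distribution $\pi$; $P_x=P(x,\cdot)$, and $W_1(\delta_x,P_x)<\infty$ for every $x$. $P^k_x$ is the $k$-step kernel, $P^0_x=\delta_x$. $W_1(\mu_1,\mu_2)=\inf\mathbb{E}(d(X,Y))$ over all couplings $(X,Y)$ of $\mu_1,\mu_2$. Multi-step coarse Ricci curvature: $\kappa_k(x,y)=1-W_1(P^k_x,P^k_y)/d(x,y)$ for $x\ne y$, $\kappa_k(x,x)=1$, $\kappa_k=\inf_{x,y\in\Omega}\kappa_k(x,y)$. Coarse diffusion constant at $x$: $\sigma(x)=\left(\frac12\iint d(y,z)^2\,\mathrm{d}P_x(y)\,\mathrm{d}P_x(z)\right)^{1/2}$. Local dimension at $x$: $n(x)=\sigma(x)^2/\sup\{\mathrm{Var}_{P_x}f : f:\mathrm{Supp}\,P_x\to\mathbb{R}\ 1\text{-Lipschitz}\}$. Thus $\sigma^2(x)/n(x)=\sup\{\mathrm{Var}_{P_x}f: f:\mathrm{Supp}\,P_x\to\mathbb{R}\ 1\text{-Lipschitz}\}$, which is also how the quotient is read when $\sigma(x)\in\{0,\infty\}$.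 *)

theory Defs
  imports "HOL-Probability.Probability"
begin

definition couplings :: "'a::topological_space measure \<Rightarrow> 'a measure \<Rightarrow> ('a \<times> 'a) measure set" where
  "couplings \<mu> \<nu> = {Q \<in> space (prob_algebra (borel \<Otimes>\<^sub>M borel)).
     distr Q borel fst = \<mu> \<and> distr Q borel snd = \<nu>}"

definition W1 :: "'a::metric_space measure \<Rightarrow> 'a measure \<Rightarrow> ennreal" where
  "W1 \<mu> \<nu> = (INF Q\<in>couplings \<mu> \<nu>. \<integral>\<^sup>+ (x, y). ennreal (dist x y) \<partial>Q)"

primrec kernel_pow :: "('a::topological_space \<Rightarrow> 'a measure) \<Rightarrow> nat \<Rightarrow> 'a \<Rightarrow> 'a measure" where
  "kernel_pow P 0 x = return borel x"
| "kernel_pow P (Suc k) x = kernel_pow P k x \<bind> P"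

(* Values in ereal: for k \<ge> 2 the distance between the k-step kernels may be infinite,
   in which case the curvature is -\<infinity>. *)
definition curvature_at ::
    "('a::metric_space \<Rightarrow> 'a measure) \<Rightarrow> nat \<Rightarrow> 'a \<Rightarrow> 'a \<Rightarrow> ereal" where
  "curvature_at P k x y =
     (if x = y then 1
      else 1 - enn2ereal (W1 (kernel_pow P k x) (kernel_pow P k y)) / ereal (dist x y))"

definition curvature :: "('a::metric_space \<Rightarrow> 'a measure) \<Rightarrow> nat \<Rightarrow> ereal" where
  "curvature P k = (INF (x, y)\<in>UNIV. curvature_at P k x y)"

(* The curvature is at most 1 (take x = y), so e2ennreal truncates nothing here. *)
definition curvature_series :: "('a::metric_space \<Rightarrow> 'a measure) \<Rightarrow> ennreal" where
  "curvature_series P = (\<Sum>k. (e2ennreal (1 - curvature P k))\<^sup>2)"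

(* Always defined, possibly infinite: a function that is not square-integrable, in particular
   one that is not integrable, has infinite variance. *)
definition ext_variance :: "'a measure \<Rightarrow> ('a \<Rightarrow> real) \<Rightarrow> ennreal" where
  "ext_variance M f =
     (if integrable M f then \<integral>\<^sup>+ x. ennreal ((f x - integral\<^sup>L M f)\<^sup>2) \<partial>M else \<infinity>)"

definition measure_support :: "'a::topological_space measure \<Rightarrow> 'a set" where
  "measure_support M = {x. \<forall>U. open U \<longrightarrow> x \<in> U \<longrightarrow> emeasure M U > 0}"

definition ennreal_sqrt :: "ennreal \<Rightarrow> ennreal" where
  "ennreal_sqrt a = (if a = \<infinity> then \<infinity> else ennreal (sqrt (enn2real a)))"

definition diffusion :: "('a::metric_space \<Rightarrow> 'a measure) \<Rightarrow> 'a \<Rightarrow> ennreal" where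
  "diffusion P x =
     ennreal_sqrt ((\<integral>\<^sup>+ z. \<integral>\<^sup>+ y. ennreal ((dist y z)\<^sup>2) \<partial>P x \<partial>P x) / 2)"

(* The test functions live on the support of P x only: a total function f stands for its
   restriction, so the variance is taken in the restricted space and the (arbitrary, possibly
   non-measurable) values of f off the support play no role. *)
definition max_variance :: "('a::metric_space \<Rightarrow> 'a measure) \<Rightarrow> 'a \<Rightarrow> ennreal" where
  "max_variance P x =
     (SUP f\<in>{f :: 'a \<Rightarrow> real. 1-lipschitz_on (measure_support (P x)) f}.
        ext_variance (restrict_space (P x) (measure_support (P x))) f)"

definition local_dimension :: "('a::metric_space \<Rightarrow> 'a measure) \<Rightarrow> 'a \<Rightarrow> ennreal" where
  "local_dimension P x = (diffusion P x)\<^sup>2 / max_variance P x"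

(* The quotient \<sigma>(x)^2 / n(x). When \<sigma>(x) is 0 or \<infinity> the local dimension is an
   indeterminate 0/0 or \<infinity>/\<infinity>, and the quotient is by convention the maximal variance. *)
definition diffusion_per_dimension :: "('a::metric_space \<Rightarrow> 'a measure) \<Rightarrow> 'a \<Rightarrow> ennreal" where
  "diffusion_per_dimension P x =
     (if diffusion P x = 0 \<or> diffusion P x = \<infinity> then max_variance P x
      else (diffusion P x)\<^sup>2 / local_dimension P x)"

end

theory Submission
  imports Defs
begin

text \<open>Suppose first that f is bounded. Iterating the law of total variance for the stationary kernel
  gives, for every m, that the variance of f under \<open>\<pi>\<close> is the sum over k < m of the integrals of
  \<open>Var\<^bsub>P x\<^esub> (P\<^sup>k f)\<close>, plus the variance of \<open>P\<^sup>m f\<close> under \<open>\<pi>\<close>. Integrating along couplings,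
  \<open>P\<^sup>k f\<close> is Lipschitz with constant \<open>1 - \<kappa>\<^sub>k\<close>, so the k-th summand is at most \<open>(1 - \<kappa>\<^sub>k)\<^sup>2\<close> times the
  integral of the maximal variance, and if the series converges then the Lipschitz constants tend
  to 0, hence so does the remainder, by dominated convergence. An arbitrary f is the limit of its
  truncations, which are again 1-Lipschitz, so neither integrability of f under \<open>\<pi>\<close> nor finiteness
  of its first moments under the k-step kernels has to be established beforehand.\<close>

section \<open>Variance\<close>

context prob_space
begin

text \<open>Expanding the square reduces everything to the first two moments. The centre
  \<open>c\<close> is left free so that the variance formula (\<open>c\<close> the mean) and the
  shift formula both follow.\<close>

lemma nn_integral_square_diff:
  fixes f :: "'a \<Rightarrow> real"
  assumes [measurable]: "f \<in> borel_measurable M" and sq: "integrable M (\<lambda>x. (f x)\<^sup>2)"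
  shows "(\<integral>\<^sup>+x. ennreal ((f x - c)\<^sup>2) \<partial>M)
    = ennreal (expectation (\<lambda>x. (f x)\<^sup>2) - (expectation f)\<^sup>2 + (expectation f - c)\<^sup>2)"
proof -
  have f: "integrable M f"
    by (rule square_integrable_imp_integrable) (use sq in auto)
  have eq: "(f x - c)\<^sup>2 = (f x)\<^sup>2 - 2 * c * f x + c\<^sup>2" for x
    by (simp add: power2_eq_square algebra_simps)
  have "integrable M (\<lambda>x. (f x - c)\<^sup>2)"
    unfolding eq using f sq by auto
  then have "(\<integral>\<^sup>+x. ennreal ((f x - c)\<^sup>2) \<partial>M) = ennreal (expectation (\<lambda>x. (f x - c)\<^sup>2))"
    by (intro nn_integral_eq_integral) auto
  also have "expectation (\<lambda>x. (f x - c)\<^sup>2) = expectation (\<lambda>x. (f x)\<^sup>2) - 2 * c * expectation f + c\<^sup>2"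
    unfolding eq using f sq by (simp add: prob_space)
  also have "\<dots> = expectation (\<lambda>x. (f x)\<^sup>2) - (expectation f)\<^sup>2 + (expectation f - c)\<^sup>2"
    by (simp add: power2_eq_square algebra_simps)
  finally show ?thesis .
qed

lemma ext_variance_square_integrable:
  fixes f :: "'a \<Rightarrow> real"
  assumes [measurable]: "f \<in> borel_measurable M" and sq: "integrable M (\<lambda>x. (f x)\<^sup>2)"
  shows "ext_variance M f = ennreal (expectation (\<lambda>x. (f x)\<^sup>2) - (expectation f)\<^sup>2)"
  using square_integrable_imp_integrable[OF assms] nn_integral_square_diff[OF assms, of "expectation f"]
  by (simp add: ext_variance_def)

lemma expectation_square_le:
  fixes f :: "'a \<Rightarrow> real"
  assumes [measurable]: "f \<in> borel_measurable M" and sq: "integrable M (\<lambda>x. (f x)\<^sup>2)"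
  shows "(expectation f)\<^sup>2 \<le> expectation (\<lambda>x. (f x)\<^sup>2)"
  using variance_eq[OF square_integrable_imp_integrable[OF assms] sq] variance_positive[of f]
  by simp

text \<open>The split into variance and squared bias. It also shows that the mean squared deviation
  about any point dominates the variance, which is how the remainder term is estimated
  later.\<close>

lemma nn_integral_square_diff_ext_variance:
  fixes f :: "'a \<Rightarrow> real"
  assumes "f \<in> borel_measurable M" and "integrable M (\<lambda>x. (f x)\<^sup>2)"
  shows "(\<integral>\<^sup>+x. ennreal ((f x - c)\<^sup>2) \<partial>M) = ext_variance M f + ennreal ((expectation f - c)\<^sup>2)"
  using expectation_square_le[OF assms]
  by (simp add: nn_integral_square_diff[OF assms] ext_variance_square_integrable[OF assms]
        flip: ennreal_plus)

text \<open>By the shift formula with \<open>c = f y\<close>, the inner integral is the variance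
  plus the squared deviation of \<open>f y\<close> from the mean, and the latter integrates to the
  variance once more. This expresses the variance without the mean.\<close>

lemma nn_integral_nn_integral_square_diff:
  fixes f :: "'a \<Rightarrow> real"
  assumes m [measurable]: "f \<in> borel_measurable M" and sq: "integrable M (\<lambda>x. (f x)\<^sup>2)"
  shows "(\<integral>\<^sup>+y. \<integral>\<^sup>+x. ennreal ((f x - f y)\<^sup>2) \<partial>M \<partial>M) = 2 * ext_variance M f"
proof -
  have "(\<integral>\<^sup>+y. ennreal ((expectation f - f y)\<^sup>2) \<partial>M) = ext_variance M f"
    using nn_integral_square_diff_ext_variance[OF assms, of "expectation f"]
    by (simp add: power2_commute[of "expectation f"])
  then show ?thesis
    by (simp add: nn_integral_square_diff_ext_variance[OF assms] nn_integral_add emeasure_space_1 mult_2)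
qed

lemma square_integrable_bounded:
  fixes f :: "'a \<Rightarrow> real"
  assumes "f \<in> borel_measurable M" "\<And>x. \<bar>f x\<bar> \<le> B"
  shows "integrable M (\<lambda>x. (f x)\<^sup>2)"
proof (rule integrable_const_bound)
  have "(f x)\<^sup>2 \<le> B\<^sup>2" for x
    using power_mono[OF assms(2) abs_ge_zero, of x 2] by simp
  then show "AE x in M. norm ((f x)\<^sup>2) \<le> B\<^sup>2"
    by simp
  show "(\<lambda>x. (f x)\<^sup>2) \<in> borel_measurable M"
    using assms(1) by measurable
qed

text \<open>Fatou's lemma is applied to the double integral of the squared differences, which does not
  involve the means: they need not converge a priori.\<close>

lemma ext_variance_le_of_clamp:
  fixes f :: "'a \<Rightarrow> real"
  assumes [measurable]: "f \<in> borel_measurable M"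
    and bound: "\<And>n. ext_variance M (\<lambda>x. max (- real n) (min (f x) (real n))) \<le> R"
  shows "ext_variance M f \<le> R"
proof (cases "R = \<infinity>")
  case False
  define g where "g n x = max (- real n) (min (f x) (real n))" for n x
  have [measurable]: "g n \<in> borel_measurable M" for n
    unfolding g_def by measurable
  have g_eq: "eventually (\<lambda>n. g n x = f x) sequentially" for x
  proof -
    obtain N where "\<bar>f x\<bar> \<le> real N"
      using real_arch_simple by blast
    then show ?thesis
      by (intro eventually_sequentiallyI[of N]) (auto simp: g_def)
  qed
  let ?I = "\<lambda>h. \<integral>\<^sup>+y. \<integral>\<^sup>+x. ennreal ((h x - h y)\<^sup>2) \<partial>M \<partial>M"
  \<comment> \<open>At fixed points the sequence is eventually constant, so the limit inferior is an
    exact value.\<close>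
  have lim: "liminf (\<lambda>n. ennreal ((g n x - g n y)\<^sup>2)) = ennreal ((f x - f y)\<^sup>2)" for x y
    by (intro lim_imp_Liminf tendsto_eventually trivial_limit_sequentially)
      (use g_eq[of x] g_eq[of y] in eventually_elim, simp)
  have "?I f = (\<integral>\<^sup>+y. \<integral>\<^sup>+x. liminf (\<lambda>n. ennreal ((g n x - g n y)\<^sup>2)) \<partial>M \<partial>M)"
    unfolding lim ..
  also have "\<dots> \<le> (\<integral>\<^sup>+y. liminf (\<lambda>n. \<integral>\<^sup>+x. ennreal ((g n x - g n y)\<^sup>2) \<partial>M) \<partial>M)"
    by (intro nn_integral_mono nn_integral_liminf) measurable
  also have "\<dots> \<le> liminf (\<lambda>n. ?I (g n))"
    by (intro nn_integral_liminf) measurable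
  also have "\<dots> \<le> liminf (\<lambda>n. 2 * R)"
  proof (intro Liminf_mono always_eventually allI)
    fix n
    have "?I (g n) = 2 * ext_variance M (g n)"
      by (intro nn_integral_nn_integral_square_diff square_integrable_bounded[of _ "real n"])
        (auto simp: g_def)
    then show "?I (g n) \<le> 2 * R"
      using bound[of n] by (simp add: g_def[abs_def] mult_left_mono)
  qed
  finally have I: "?I f \<le> 2 * R"
    by (simp add: Liminf_const)
  have "?I f \<noteq> \<infinity>"
    using I False by (auto simp: top_unique ennreal_mult_eq_top_iff)
  then have "AE y in M. (\<integral>\<^sup>+x. ennreal ((f x - f y)\<^sup>2) \<partial>M) \<noteq> \<infinity>"
    by (intro nn_integral_noteq_infinite) auto
  \<comment> \<open>A property that holds almost everywhere in a probability space has a witness.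
    Centred at the value \<open>f y\<close>, the function is square-integrable, and hence so is
    \<open>f\<close> itself.\<close>
  then obtain y where y: "(\<integral>\<^sup>+x. ennreal ((f x - f y)\<^sup>2) \<partial>M) \<noteq> \<infinity>"
    using eventually_happens'[OF ae_filter_bot] by blast
  have sq': "integrable M (\<lambda>x. (f x - f y)\<^sup>2)"
    by (intro integrableI_bounded) (use y in \<open>auto simp: less_top\<close>)
  have "integrable M (\<lambda>x. f x - f y)"
    by (rule square_integrable_imp_integrable[OF _ sq']) measurable
  then have "integrable M (\<lambda>x. (f x - f y)\<^sup>2 + 2 * f y * (f x - f y) + (f y)\<^sup>2)"
    using sq' by (intro Bochner_Integration.integrable_add) auto
  moreover have "(f x - f y)\<^sup>2 + 2 * f y * (f x - f y) + (f y)\<^sup>2 = (f x)\<^sup>2" for x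
    by (simp add: power2_eq_square algebra_simps)
  ultimately have "integrable M (\<lambda>x. (f x)\<^sup>2)"
    by simp
  from nn_integral_nn_integral_square_diff[OF _ this] I have "2 * ext_variance M f \<le> 2 * R"
    by simp
  then show ?thesis
    by (simp add: ennreal_mult_le_mult_iff)
qed simp

end

section \<open>Supports of measures, and the quotient of diffusion by dimension\<close>

lemma closed_measure_support: "closed (measure_support M)"
proof -
  have "- measure_support M = \<Union>{U. open U \<and> emeasure M U = 0}"
    by (auto simp: measure_support_def)
  then show ?thesis
    by (simp add: closed_def open_Union)
qed

text \<open>The complement of the support is the union of all open null sets. By the Lindelof
  property countably many of them already cover it, so it is null.\<close>

lemma AE_measure_support:
  fixes M :: "'a::second_countable_topology measure"
  assumes sets: "sets M = sets borel"
  shows "AE x in M. x \<in> measure_support M"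
proof -
  let ?F = "{U. open U \<and> emeasure M U = 0}"
  obtain F where F: "F \<subseteq> ?F" "countable F" "\<Union>F = \<Union>?F"
    using Lindelof[of ?F] by auto
  have "\<Union>F \<in> null_sets M"
    using F(1,2) null_sets_UN'[of F "\<lambda>U. U" M] by (force simp: null_sets_def sets)
  then have "AE x in M. x \<notin> \<Union>F"
    by (rule AE_not_in)
  then show ?thesis
    unfolding F(3) by eventually_elim (auto simp: measure_support_def zero_less_iff_neq_zero)
qed

text \<open>The support carries full measure. This lets Borel functions on the whole space serve as
  test functions in \<open>max_variance\<close>.\<close>

lemma ext_variance_restrict_measure_support:
  fixes M :: "'a::second_countable_topology measure" and f :: "'a \<Rightarrow> real"
  assumes sets: "sets M = sets borel" and f: "f \<in> borel_measurable borel"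
  shows "ext_variance (restrict_space M (measure_support M)) f = ext_variance M f"
proof -
  let ?S = "measure_support M"
  have [measurable]: "f \<in> borel_measurable M" "?S \<in> sets M"
    using f closed_measure_support[of M] by (auto simp: sets cong: measurable_cong_sets)
  have S: "?S \<inter> space M \<in> sets M"
    by measurable
  have AE: "AE x in M. indicator ?S x *\<^sub>R f x = f x"
    using AE_measure_support[OF sets] by eventually_elim simp
  have 1: "integrable (restrict_space M ?S) f \<longleftrightarrow> integrable M f"
    unfolding integrable_restrict_space[OF S] by (rule integrable_cong_AE) (use AE in auto)
  have 2: "integral\<^sup>L (restrict_space M ?S) f = integral\<^sup>L M f"
    unfolding integral_restrict_space[OF S] by (rule integral_cong_AE) (use AE in auto)
  have 3: "(\<integral>\<^sup>+x. ennreal ((f x - c)\<^sup>2) \<partial>restrict_space M ?S) = (\<integral>\<^sup>+x. ennreal ((f x - c)\<^sup>2) \<partial>M)" for c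
    unfolding nn_integral_restrict_space[OF S]
    by (rule nn_integral_cong_AE) (use AE_measure_support[OF sets] in eventually_elim, simp)
  show ?thesis
    by (simp add: ext_variance_def 1 2 3)
qed

text \<open>For positive finite diffusion the quotient cancels even at the extremes: maximal
  variance 0 gives dimension \<infinity> and quotient 0, and maximal variance \<infinity> gives
  dimension 0 and quotient \<infinity>.\<close>

lemma diffusion_per_dimension_eq: "diffusion_per_dimension P x = max_variance P x"
proof (cases "diffusion P x = 0 \<or> diffusion P x = \<infinity>")
  case False
  then obtain s where s: "diffusion P x = ennreal s" "s > 0"
    by (cases "diffusion P x") (auto simp: order_less_le)
  show ?thesis
  proof (cases "max_variance P x")
    case (real v)
    show ?thesis
    proof (cases "v = 0")
      case True
      with False real s show ?thesis
        by (simp add: diffusion_per_dimension_def local_dimension_def ennreal_power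
            ennreal_divide_zero)
    next
      case v: False
      with real s have "s\<^sup>2 / (s\<^sup>2 / v) = v" "s\<^sup>2 / v > 0"
        by auto
      with False real s v show ?thesis
        by (simp add: diffusion_per_dimension_def local_dimension_def ennreal_power divide_ennreal)
    qed
  next
    case top
    with False s show ?thesis
      by (simp add: diffusion_per_dimension_def local_dimension_def ennreal_power)
  qed
qed (simp add: diffusion_per_dimension_def)

section \<open>Wasserstein distance and Lipschitz functions\<close>

text \<open>The easy half of Kantorovich duality: under each coupling the difference of the
  integrals is an integral of \<open>g x - g y\<close>. Boundedness of \<open>g\<close> makes both
  terms integrable under the coupling, so they may be subtracted.\<close>

lemma abs_integral_diff_le_W1:
  fixes g :: "'a::metric_space \<Rightarrow> real"
  assumes [measurable]: "g \<in> borel_measurable borel" and bound: "\<And>x. \<bar>g x\<bar> \<le> B"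
    and lip: "1-lipschitz_on UNIV g"
  shows "ennreal \<bar>(\<integral>x. g x \<partial>\<mu>) - (\<integral>x. g x \<partial>\<nu>)\<bar> \<le> W1 \<mu> \<nu>"
  unfolding W1_def
proof (rule INF_greatest)
  fix Q assume Q: "Q \<in> couplings \<mu> \<nu>"
  then interpret Q: prob_space Q
    by (auto simp: couplings_def space_prob_algebra)
  have [measurable_cong]: "sets Q = sets (borel \<Otimes>\<^sub>M borel)"
    using Q by (auto simp: couplings_def space_prob_algebra)
  have \<mu>: "(\<integral>x. g x \<partial>\<mu>) = (\<integral>p. g (fst p) \<partial>Q)" and \<nu>: "(\<integral>x. g x \<partial>\<nu>) = (\<integral>p. g (snd p) \<partial>Q)"
    using Q by (auto simp: couplings_def integral_distr)
  have int: "integrable Q (\<lambda>p. g (fst p))" "integrable Q (\<lambda>p. g (snd p))"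
    by (rule Q.integrable_const_bound[where B=B]; simp add: bound)+
  have "ennreal \<bar>(\<integral>x. g x \<partial>\<mu>) - (\<integral>x. g x \<partial>\<nu>)\<bar> \<le> ennreal (\<integral>p. \<bar>g (fst p) - g (snd p)\<bar> \<partial>Q)"
    unfolding \<mu> \<nu> using int by (simp flip: Bochner_Integration.integral_diff)
  also have "\<dots> = (\<integral>\<^sup>+p. ennreal \<bar>g (fst p) - g (snd p)\<bar> \<partial>Q)"
    using int by (intro nn_integral_eq_integral[symmetric]) auto
  also have "\<dots> \<le> (\<integral>\<^sup>+(x, y). ennreal (dist x y) \<partial>Q)"
    using lipschitz_onD[OF lip] by (intro nn_integral_mono) (auto simp: dist_real_def)
  finally show "ennreal \<bar>(\<integral>x. g x \<partial>\<mu>) - (\<integral>x. g x \<partial>\<nu>)\<bar> \<le> (\<integral>\<^sup>+(x, y). ennreal (dist x y) \<partial>Q)" .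
qed

lemma W1_kernel_pow_le:
  assumes l: "e2ennreal (1 - curvature P k) = ennreal l" and "l \<ge> 0" and "x \<noteq> y"
  shows "W1 (kernel_pow P k x) (kernel_pow P k y) \<le> ennreal (l * dist x y)"
proof -
  let ?W = "W1 (kernel_pow P k x) (kernel_pow P k y)"
  have d: "dist x y > 0"
    using \<open>x \<noteq> y\<close> by simp
  \<comment> \<open>The diagonal pair bounds the curvature by 1, so that \<open>e2ennreal\<close>
    does not truncate; the pair of distinct points carries the actual estimate.\<close>
  have "curvature P k \<le> curvature_at P k x x" "curvature P k \<le> curvature_at P k x y"
    unfolding curvature_def
    using INF_lower[of "(x, x)" UNIV "\<lambda>(x, y). curvature_at P k x y"]
      INF_lower[of "(x, y)" UNIV "\<lambda>(x, y). curvature_at P k x y"] by auto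
  then have le: "curvature P k \<le> 1" "curvature P k \<le> 1 - enn2ereal ?W / ereal (dist x y)"
    using \<open>x \<noteq> y\<close> by (auto simp: curvature_at_def)
  have "1 - curvature P k = ereal l"
  proof -
    have "1 - curvature P k \<ge> 0"
      using le(1) by (cases "curvature P k") (auto simp: one_ereal_def)
    then have "1 - curvature P k = enn2ereal (e2ennreal (1 - curvature P k))"
      by (simp add: enn2ereal_e2ennreal)
    then show ?thesis
      using l \<open>l \<ge> 0\<close> by (simp add: enn2ereal_ennreal)
  qed
  then have "curvature P k = ereal (1 - l)"
    by (cases "curvature P k") (auto simp: one_ereal_def)
  \<comment> \<open>An infinite distance would force the curvature to be -\<infinity>, but it is the
    real number \<open>1 - l\<close>.\<close>
  with le(2) d obtain w where w: "?W = ennreal w" "w \<ge> 0"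
    by (cases ?W) (auto simp: one_ereal_def)
  with \<open>curvature P k = ereal (1 - l)\<close> le(2) d have "1 - l \<le> 1 - w / dist x y"
    by (simp add: one_ereal_def enn2ereal_ennreal)
  with d have "w \<le> l * dist x y"
    by (simp add: field_simps)
  then show ?thesis
    unfolding w(1) by (rule ennreal_leI)
qed

section \<open>The averaging operator of a kernel\<close>

text \<open>The Markov operator, acting on functions. For bounded Borel \<open>g\<close>, the case
  of interest, the integral exists at every point, so the default value 0 does not
  intervene.\<close>

definition kernel_op :: "('a \<Rightarrow> 'a measure) \<Rightarrow> ('a \<Rightarrow> real) \<Rightarrow> 'a \<Rightarrow> real" where
  "kernel_op P g x = (\<integral>y. g y \<partial>P x)"

context
  fixes P :: "'a::polish_space \<Rightarrow> 'a measure"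
  assumes kernel: "P \<in> borel \<rightarrow>\<^sub>M prob_algebra borel"
begin

lemma kernel_prob_space: "prob_space (P x)"
  and sets_kernel_borel: "sets (P x) = sets borel"
  using measurable_space[OF kernel, of x] by (auto simp: space_prob_algebra)

lemma kernel_subprob [measurable]: "P \<in> borel \<rightarrow>\<^sub>M subprob_algebra borel"
  using kernel by (rule measurable_prob_algebraD)

lemma kernel_op_measurable [measurable]:
  assumes "g \<in> borel_measurable borel"
  shows "kernel_op P g \<in> borel_measurable borel"
  unfolding kernel_op_def[abs_def]
  using measurable_compose[OF kernel_subprob integral_measurable_subprob_algebra[OF assms]] .

lemma kernel_op_bounded:
  assumes g: "g \<in> borel_measurable borel" and B: "\<And>x. \<bar>g x\<bar> \<le> B"
  shows "\<bar>kernel_op P g x\<bar> \<le> B"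
proof -
  interpret prob_space "P x" by (rule kernel_prob_space)
  have [measurable]: "g \<in> borel_measurable (P x)"
    using g by (simp add: sets_kernel_borel cong: measurable_cong_sets)
  have "integrable (P x) g"
    by (rule integrable_const_bound[where B=B]) (auto simp: B)
  then have "\<bar>kernel_op P g x\<bar> \<le> (\<integral>y. \<bar>g y\<bar> \<partial>P x)" "(\<integral>y. \<bar>g y\<bar> \<partial>P x) \<le> (\<integral>y. B \<partial>P x)"
    unfolding kernel_op_def by (simp, intro integral_mono integrable_abs) (auto simp: B)
  then show ?thesis
    by (simp add: prob_space)
qed

section \<open>Iterates of the averaging operator and their Lipschitz constants\<close>

lemma kernel_op_iterate_measurable [measurable]:
  "g \<in> borel_measurable borel \<Longrightarrow> (kernel_op P ^^ k) g \<in> borel_measurable borel"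
  by (induction k) auto

lemma kernel_op_iterate_bounded:
  assumes "g \<in> borel_measurable borel" "\<And>x. \<bar>g x\<bar> \<le> B"
  shows "\<bar>(kernel_op P ^^ k) g x\<bar> \<le> B"
proof (induction k arbitrary: x)
  case (Suc k)
  then show ?case
    using kernel_op_bounded[OF kernel_op_iterate_measurable[OF assms(1)]] by simp
qed (simp add: assms)

lemma integral_bind_kernel:
  assumes M: "M \<in> space (prob_algebra borel)"
    and g: "g \<in> borel_measurable borel" "\<And>x. \<bar>g x\<bar> \<le> B"
  shows "(\<integral>x. g x \<partial>(M \<bind> P)) = (\<integral>x. kernel_op P g x \<partial>M)"
  unfolding kernel_op_def
proof (rule integral_bind[where K=borel and B=B and B'=1])
  show "finite_measure M" "P \<in> M \<rightarrow>\<^sub>M subprob_algebra borel"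
    using M by (auto simp: space_prob_algebra prob_space.finite_measure cong: measurable_cong_sets)
  show "AE x in M. emeasure (P x) (space (P x)) \<le> ennreal 1"
    by (simp add: prob_space.emeasure_space_1[OF kernel_prob_space])
qed (use g in auto)

lemma kernel_pow_in_prob_algebra: "kernel_pow P k x \<in> space (prob_algebra borel)"
proof -
  have "kernel_pow P k \<in> borel \<rightarrow>\<^sub>M prob_algebra borel"
  proof (induction k)
    case 0
    have "kernel_pow P 0 = return borel"
      by auto
    then show ?case
      by (simp add: return_measurable measurable_return_prob_space)
  next
    case (Suc k)
    have "kernel_pow P (Suc k) = (\<lambda>x. kernel_pow P k x \<bind> P)"
      by auto
    then show ?case
      using measurable_bind_prob_space[OF Suc kernel] by simp
  qed
  from measurable_space[OF this, of x] show ?thesis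
    by simp
qed

text \<open>The last step of the chain is integrated out first, which replaces \<open>g\<close> by
  \<open>kernel_op P g\<close>; hence the induction is over all \<open>g\<close>.\<close>

lemma integral_kernel_pow:
  assumes "g \<in> borel_measurable borel" "\<And>x. \<bar>g x\<bar> \<le> B"
  shows "(\<integral>y. g y \<partial>kernel_pow P k x) = (kernel_op P ^^ k) g x"
  using assms
proof (induction k arbitrary: g)
  case 0
  then show ?case
    by (simp add: integral_return)
next
  case (Suc k)
  have "(\<integral>y. g y \<partial>kernel_pow P (Suc k) x) = (\<integral>y. kernel_op P g y \<partial>kernel_pow P k x)"
    using integral_bind_kernel[OF kernel_pow_in_prob_algebra Suc.prems] by simp
  also have "\<dots> = (kernel_op P ^^ k) (kernel_op P g) x"
    using Suc.prems by (intro Suc.IH kernel_op_measurable kernel_op_bounded)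
  finally show ?case
    by (simp add: funpow_swap1)
qed

text \<open>Curvature enters here: the duality bound controls the difference of the iterates by the
  distance of the k-step kernels, which the curvature bounds by \<open>l * dist x y\<close>.\<close>

lemma kernel_op_iterate_lipschitz:
  assumes g: "g \<in> borel_measurable borel" "\<And>x. \<bar>g x\<bar> \<le> B" and lip: "1-lipschitz_on UNIV g"
    and l: "e2ennreal (1 - curvature P k) = ennreal l" "l \<ge> 0"
  shows "l-lipschitz_on UNIV ((kernel_op P ^^ k) g)"
proof (rule lipschitz_onI)
  fix x y
  show "dist ((kernel_op P ^^ k) g x) ((kernel_op P ^^ k) g y) \<le> l * dist x y"
  proof (cases "x = y")
    case False
    have "ennreal \<bar>(kernel_op P ^^ k) g x - (kernel_op P ^^ k) g y\<bar>
        \<le> W1 (kernel_pow P k x) (kernel_pow P k y)"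
      using abs_integral_diff_le_W1[OF g lip, of "kernel_pow P k x" "kernel_pow P k y"]
      by (simp add: integral_kernel_pow[OF g])
    also have "\<dots> \<le> ennreal (l * dist x y)"
      by (rule W1_kernel_pow_le[OF l False])
    finally show ?thesis
      using l(2) by (simp add: dist_real_def)
  qed simp
qed (rule l)

section \<open>Decomposition of the variance under a stationary law\<close>

lemma ext_variance_kernel:
  assumes g: "g \<in> borel_measurable borel" "\<And>x. \<bar>g x\<bar> \<le> B"
  shows "ext_variance (P x) g = ennreal (kernel_op P (\<lambda>y. (g y)\<^sup>2) x - (kernel_op P g x)\<^sup>2)"
    and "(kernel_op P g x)\<^sup>2 \<le> kernel_op P (\<lambda>y. (g y)\<^sup>2) x"
proof -
  interpret prob_space "P x" by (rule kernel_prob_space)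
  have m: "g \<in> borel_measurable (P x)"
    using g by (simp add: sets_kernel_borel cong: measurable_cong_sets)
  note sq = square_integrable_bounded[OF m g(2)]
  show "ext_variance (P x) g = ennreal (kernel_op P (\<lambda>y. (g y)\<^sup>2) x - (kernel_op P g x)\<^sup>2)"
    and "(kernel_op P g x)\<^sup>2 \<le> kernel_op P (\<lambda>y. (g y)\<^sup>2) x"
    using ext_variance_square_integrable[OF m sq] expectation_square_le[OF m sq]
    by (simp_all add: kernel_op_def)
qed

lemma ext_variance_kernel_measurable:
  assumes g: "g \<in> borel_measurable borel" "\<And>x. \<bar>g x\<bar> \<le> B"
  shows "(\<lambda>x. ext_variance (P x) g) \<in> borel_measurable borel"
  unfolding ext_variance_kernel(1)[OF g] using g(1) by measurable

text \<open>The law of total variance for one step of the chain started from \<pi>. Stationarity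
  gives \<open>kernel_op P\<close> of \<open>g\<close> and of its square the same \<pi>-means as
  these functions, so the second moment of \<open>kernel_op P g\<close> cancels.\<close>

lemma ext_variance_stationary:
  assumes prob: "\<pi> \<in> space (prob_algebra borel)" and stationary: "\<pi> \<bind> P = \<pi>"
    and g: "g \<in> borel_measurable borel" "\<And>x. \<bar>g x\<bar> \<le> B"
  shows "ext_variance \<pi> g = (\<integral>\<^sup>+x. ext_variance (P x) g \<partial>\<pi>) + ext_variance \<pi> (kernel_op P g)"
proof -
  interpret prob_space \<pi>
    using prob by (simp add: space_prob_algebra)
  have [measurable_cong]: "sets \<pi> = sets borel"
    using prob by (simp add: space_prob_algebra)
  note g(1) [measurable]
  have sq: "(\<lambda>y. (g y)\<^sup>2) \<in> borel_measurable borel" "\<bar>(g y)\<^sup>2\<bar> \<le> B\<^sup>2" for y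
    using power_mono[OF g(2)[of y] abs_ge_zero, of 2] by auto
  let ?G = "kernel_op P g" and ?S = "kernel_op P (\<lambda>y. (g y)\<^sup>2)"
  have m: "g \<in> borel_measurable \<pi>" "?G \<in> borel_measurable \<pi>" "?S \<in> borel_measurable \<pi>"
    by measurable
  note G = kernel_op_bounded[OF g] and S = kernel_op_bounded[OF sq]
  note sqG = square_integrable_bounded[OF m(2) G]
  have intS: "integrable \<pi> ?S"
    by (rule integrable_const_bound[where B="B\<^sup>2"]) (use S m in auto)
  have "(\<integral>\<^sup>+x. ext_variance (P x) g \<partial>\<pi>) = ennreal (expectation (\<lambda>x. ?S x - (?G x)\<^sup>2))"
    unfolding ext_variance_kernel(1)[OF g]
    using ext_variance_kernel(2)[OF g] sqG intS by (intro nn_integral_eq_integral) auto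
  also have "expectation (\<lambda>x. ?S x - (?G x)\<^sup>2) = expectation ?S - expectation (\<lambda>x. (?G x)\<^sup>2)"
    using sqG intS by simp
  also have "expectation ?S = expectation (\<lambda>x. (g x)\<^sup>2)"
    using integral_bind_kernel[OF prob sq] by (simp add: stationary)
  finally have 1: "(\<integral>\<^sup>+x. ext_variance (P x) g \<partial>\<pi>)
      = ennreal (expectation (\<lambda>x. (g x)\<^sup>2) - expectation (\<lambda>x. (?G x)\<^sup>2))" .
  have "expectation (\<lambda>x. (?G x)\<^sup>2) \<le> expectation ?S"
    using ext_variance_kernel(2)[OF g] sqG intS by (intro integral_mono)
  with \<open>expectation ?S = _\<close> have le: "expectation (\<lambda>x. (?G x)\<^sup>2) \<le> expectation (\<lambda>x. (g x)\<^sup>2)"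
    by simp
  have E: "expectation ?G = expectation g"
    using integral_bind_kernel[OF prob g] by (simp add: stationary)
  show ?thesis
    unfolding 1 ext_variance_square_integrable[OF m(2) sqG]
      ext_variance_square_integrable[OF m(1) square_integrable_bounded[OF m(1) g(2)]] E
    using le expectation_square_le[OF m(2) sqG] E by (simp flip: ennreal_plus)
qed

text \<open>Telescoping: the one-step identity is applied to each iterate in turn.\<close>

lemma ext_variance_stationary_iterate:
  assumes prob: "\<pi> \<in> space (prob_algebra borel)" and stationary: "\<pi> \<bind> P = \<pi>"
    and g: "g \<in> borel_measurable borel" "\<And>x. \<bar>g x\<bar> \<le> B"
  shows "ext_variance \<pi> g = (\<Sum>k<n. \<integral>\<^sup>+x. ext_variance (P x) ((kernel_op P ^^ k) g) \<partial>\<pi>)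
    + ext_variance \<pi> ((kernel_op P ^^ n) g)"
proof (induction n)
  case (Suc n)
  then show ?case
    using ext_variance_stationary[OF prob stationary kernel_op_iterate_measurable[OF g(1)]
        kernel_op_iterate_bounded[OF g], of n]
    by (simp add: add.assoc)
qed simp

text \<open>A globally 1-Lipschitz function restricts to an admissible test function on the
  support.\<close>

lemma ext_variance_le_max_variance:
  assumes g: "g \<in> borel_measurable borel" and lip: "1-lipschitz_on UNIV g"
  shows "ext_variance (P x) g \<le> max_variance P x"
proof -
  have "1-lipschitz_on (measure_support (P x)) g"
    using lip by (rule lipschitz_on_subset) simp
  then show ?thesis
    unfolding max_variance_def
    by (intro SUP_upper2[of g])
      (simp_all add: ext_variance_restrict_measure_support[OF sets_kernel_borel g])
qed

text \<open>The maximal variance need not be measurable in the starting point, so the integral on the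
  right is a lower integral. Scaling the measurable left-hand integrand, rather than the maximal
  variance, by l^2 avoids the issue.\<close>

lemma nn_integral_ext_variance_le:
  assumes prob: "\<pi> \<in> space (prob_algebra borel)"
    and g: "g \<in> borel_measurable borel" "\<And>x. \<bar>g x\<bar> \<le> B" and lip: "l-lipschitz_on UNIV g"
  shows "(\<integral>\<^sup>+x. ext_variance (P x) g \<partial>\<pi>)
    \<le> (ennreal l)\<^sup>2 * (\<integral>\<^sup>+x. max_variance P x \<partial>\<pi>)"
proof -
  have l: "l \<ge> 0"
    using lip by (rule lipschitz_on_nonneg)
  have [measurable_cong]: "sets \<pi> = sets borel"
    using prob by (simp add: space_prob_algebra)
  define h where "h x = g x / l" for x
  define c where "c = g undefined"
  have h: "h \<in> borel_measurable borel" "\<bar>h x\<bar> \<le> B / l" for x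
    using g l unfolding h_def by (auto simp: divide_right_mono)
  have eq: "ext_variance (P x) g = (ennreal l)\<^sup>2 * ext_variance (P x) h" for x
  proof -
    interpret prob_space "P x" by (rule kernel_prob_space)
    show ?thesis
    \<comment> \<open>Here division by zero makes \<open>h\<close> vanish, but \<open>g\<close> is
      then constant, so both sides are 0.\<close>
    proof (cases "l = 0")
      case True
      then have "g y = c" for y
        using lipschitz_onD[OF lip, of y undefined] by (simp add: c_def)
      then have "g = (\<lambda>_. c)"
        by auto
      then show ?thesis
        using True by (simp add: ext_variance_def prob_space)
    next
      case False
      have gh: "g = (\<lambda>x. l * h x)"
        using False by (simp add: h_def)
      have "kernel_op P (\<lambda>y. (g y)\<^sup>2) x = l\<^sup>2 * kernel_op P (\<lambda>y. (h y)\<^sup>2) x"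
        "kernel_op P g x = l * kernel_op P h x"
        by (simp_all add: gh kernel_op_def power_mult_distrib)
      then show ?thesis
        unfolding ext_variance_kernel(1)[OF g] ext_variance_kernel(1)[OF h] using l
        by (simp add: power_mult_distrib ennreal_power right_diff_distrib flip: ennreal_mult')
    qed
  qed
  have hm: "(\<lambda>x. ext_variance (P x) h) \<in> borel_measurable \<pi>"
    using ext_variance_kernel_measurable[OF h] by measurable
  have "1-lipschitz_on UNIV h"
  proof (rule lipschitz_onI)
    fix x y
    show "dist (h x) (h y) \<le> 1 * dist x y"
    proof (cases "l = 0")
      case False
      then show ?thesis
        using lipschitz_onD[OF lip, of x y] l
        by (simp add: h_def dist_real_def field_simps flip: diff_divide_distrib)
    qed (simp add: h_def)
  qed simp
  then have "(\<integral>\<^sup>+x. ext_variance (P x) h \<partial>\<pi>) \<le> (\<integral>\<^sup>+x. max_variance P x \<partial>\<pi>)"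
    by (intro nn_integral_mono ext_variance_le_max_variance h)
  then show ?thesis
    unfolding eq by (subst nn_integral_cmult[OF hm]) (rule mult_left_mono, auto)
qed

lemma ext_variance_iterate_tendsto_0:
  fixes l :: "nat \<Rightarrow> real"
  assumes prob: "\<pi> \<in> space (prob_algebra borel)"
    and g: "g \<in> borel_measurable borel" "\<And>x. \<bar>g x\<bar> \<le> B"
    and lip: "\<And>k. (l k)-lipschitz_on UNIV ((kernel_op P ^^ k) g)" and l: "l \<longlonglongrightarrow> 0"
  shows "(\<lambda>k. ext_variance \<pi> ((kernel_op P ^^ k) g)) \<longlonglongrightarrow> 0"
proof -
  interpret prob_space \<pi>
    using prob by (simp add: space_prob_algebra)
  have [measurable_cong]: "sets \<pi> = sets borel"
    using prob by (simp add: space_prob_algebra)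
  note g(1) [measurable]
  define G where "G k = (kernel_op P ^^ k) g" for k
  have [measurable]: "G k \<in> borel_measurable borel" for k
    unfolding G_def by measurable
  then have m: "G k \<in> borel_measurable \<pi>" for k
    by measurable
  have G: "\<bar>G k x\<bar> \<le> B" for k x
    unfolding G_def by (rule kernel_op_iterate_bounded[OF g])
  \<comment> \<open>A reference point. The iterates are not shown to converge themselves; their
    differences to the value at \<open>z\<close> do tend to 0, and they are bounded by
    \<open>2 * B\<close>. Recentring at that value can only increase the mean squared
    deviation.\<close>
  fix z
  have "(\<lambda>k. G k x - G k z) \<longlonglongrightarrow> 0" for x
  proof (rule Lim_null_comparison)
    show "\<forall>\<^sub>F k in sequentially. norm (G k x - G k z) \<le> l k * dist x z"
      using lipschitz_onD[OF lip, of x z] by (auto simp: G_def dist_real_def)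
    show "(\<lambda>k. l k * dist x z) \<longlonglongrightarrow> 0"
      using tendsto_mult_right[OF l, of "dist x z"] by simp
  qed
  then have pw: "(\<lambda>k. (G k x - G k z)\<^sup>2) \<longlonglongrightarrow> 0" for x
    using tendsto_power[of _ 0 sequentially 2] by fastforce
  have bd: "(G k x - G k z)\<^sup>2 \<le> (2 * B)\<^sup>2" for k x
    using G[of k x] G[of k z] by (intro power2_le_iff_abs_le[THEN iffD2]) auto
  have lim: "(\<lambda>k. \<integral>\<^sup>+x. ennreal ((G k x - G k z)\<^sup>2) \<partial>\<pi>) \<longlonglongrightarrow> (\<integral>\<^sup>+x. 0 \<partial>\<pi>)"
  proof (rule nn_integral_dominated_convergence[where w="\<lambda>_. ennreal ((2 * B)\<^sup>2)"])
    show "AE x in \<pi>. (\<lambda>k. ennreal ((G k x - G k z)\<^sup>2)) \<longlonglongrightarrow> 0"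
      using tendsto_ennrealI[OF pw] by simp
    show "AE x in \<pi>. ennreal ((G k x - G k z)\<^sup>2) \<le> ennreal ((2 * B)\<^sup>2)" for k
      using bd by (simp add: ennreal_leI)
  qed (simp_all add: emeasure_space_1)
  have "ext_variance \<pi> (G k) \<le> (\<integral>\<^sup>+x. ennreal ((G k x - G k z)\<^sup>2) \<partial>\<pi>)" for k
    using nn_integral_square_diff_ext_variance[OF m square_integrable_bounded[OF m G]] by simp
  then have "(\<lambda>k. ext_variance \<pi> (G k)) \<longlonglongrightarrow> 0"
    using tendsto_sandwich[OF _ _ tendsto_const lim, of "\<lambda>k. ext_variance \<pi> (G k)"] by simp
  then show ?thesis
    by (simp add: G_def)
qed

end

section \<open>Square-summable constants and the final estimate\<close>

lemma ennreal_square_summable_tendsto_0: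
  fixes L :: "nat \<Rightarrow> ennreal"
  assumes "(\<Sum>k. (L k)\<^sup>2) \<noteq> \<infinity>"
  obtains l where "\<And>k. L k = ennreal (l k)" "\<And>k. l k \<ge> 0" "l \<longlonglongrightarrow> 0"
proof -
  define l where "l k = enn2real (L k)" for k
  have fin: "(L k)\<^sup>2 \<noteq> \<infinity>" for k
  proof -
    \<comment> \<open>A single term is a partial sum, so an infinite term would make the series
      infinite.\<close>
    have "(\<Sum>i\<in>{k}. (L i)\<^sup>2) \<le> (\<Sum>i. (L i)\<^sup>2)"
      by (rule sum_le_suminf) auto
    then show ?thesis
      using assms by (auto simp: top_unique)
  qed
  then have L: "L k = ennreal (l k)" for k
    using fin[of k] by (cases "L k") (auto simp: l_def)
  have l: "l k \<ge> 0" for k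
    by (simp add: l_def)
  have "summable (\<lambda>k. (l k)\<^sup>2)"
    using assms by (intro summable_suminf_not_top) (simp_all add: L ennreal_power l)
  then have "(\<lambda>k. sqrt ((l k)\<^sup>2)) \<longlonglongrightarrow> sqrt 0"
    by (intro tendsto_real_sqrt summable_LIMSEQ_zero)
  then have "l \<longlonglongrightarrow> 0"
    by (simp add: l)
  with L l show ?thesis
    by (rule that)
qed

theorem theorem3p13:
  fixes P :: "'a::polish_space \<Rightarrow> 'a measure"
    and \<pi> :: "'a measure"
    and f :: "'a \<Rightarrow> real"
  assumes kernel: "P \<in> borel \<rightarrow>\<^sub>M prob_algebra borel"
    and prob: "\<pi> \<in> space (prob_algebra borel)"
    and stationary: "\<pi> \<bind> P = \<pi>"
    and finite_jump: "\<And>x. W1 (return borel x) (P x) < \<infinity>"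
    and lipschitz: "1-lipschitz_on UNIV f"
  shows "ext_variance \<pi> f \<le>
    (if curvature_series P = \<infinity> then \<infinity>
     else curvature_series P * (\<integral>\<^sup>+ x. diffusion_per_dimension P x \<partial>\<pi>))"
proof (cases "curvature_series P = \<infinity>")
  case False
  let ?E = "\<integral>\<^sup>+x. max_variance P x \<partial>\<pi>"
  let ?A = "kernel_op P"
  interpret prob_space \<pi>
    using prob by (simp add: space_prob_algebra)
  have sets: "sets \<pi> = sets borel"
    using prob by (simp add: space_prob_algebra)
  \<comment> \<open>The numbers \<open>1 - \<kappa>\<^sub>k\<close> as reals. They bound the
    Lipschitz constants of the iterates, and their convergence to 0 removes the remainder.\<close>
  obtain l where l: "\<And>k. e2ennreal (1 - curvature P k) = ennreal (l k)" "\<And>k. l k \<ge> 0" "l \<longlonglongrightarrow> 0"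
    using ennreal_square_summable_tendsto_0[OF False[unfolded curvature_series_def]] by blast
  have "f \<in> borel_measurable borel"
    using lipschitz_on_continuous_on[OF lipschitz] by (rule borel_measurable_continuous_onI)
  then have f: "f \<in> borel_measurable \<pi>"
    by (simp add: sets cong: measurable_cong_sets)
  have "ext_variance \<pi> (\<lambda>x. max (- real n) (min (f x) (real n))) \<le> curvature_series P * ?E" for n
  proof -
    define g where "g x = max (- real n) (min (f x) (real n))" for x
    have g: "g \<in> borel_measurable borel" "\<bar>g x\<bar> \<le> real n" for x
      using \<open>f \<in> borel_measurable borel\<close> unfolding g_def by auto
    have "1-lipschitz_on UNIV g"
      using lipschitz_onD[OF lipschitz]
      by (intro lipschitz_onI) (fastforce simp: g_def dist_real_def max_def min_def)+
    note lip = kernel_op_iterate_lipschitz[OF kernel g this l(1,2)]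
    have "ext_variance \<pi> g \<le> curvature_series P * ?E + ext_variance \<pi> ((?A ^^ m) g)" for m
    proof -
      have "(\<Sum>k<m. \<integral>\<^sup>+x. ext_variance (P x) ((?A ^^ k) g) \<partial>\<pi>) \<le> (\<Sum>k<m. (ennreal (l k))\<^sup>2 * ?E)"
        by (intro sum_mono kernel_op_iterate_measurable[OF kernel] g(1)
            nn_integral_ext_variance_le[OF kernel prob _ kernel_op_iterate_bounded[OF kernel g] lip])
      also have "\<dots> \<le> curvature_series P * ?E"
        unfolding curvature_series_def l(1) sum_distrib_right[symmetric]
        by (intro mult_right_mono sum_le_suminf) auto
      finally show ?thesis
        unfolding ext_variance_stationary_iterate[OF kernel prob stationary g, of m]
        by (rule add_right_mono)
    qed
    moreover have "(\<lambda>m. curvature_series P * ?E + ext_variance \<pi> ((?A ^^ m) g))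
        \<longlonglongrightarrow> curvature_series P * ?E + 0"
      by (intro tendsto_add tendsto_const ext_variance_iterate_tendsto_0[OF kernel prob g lip l(3)])
    ultimately show ?thesis
      unfolding g_def[symmetric] by (auto intro: LIMSEQ_le_const)
  qed
  \<comment> \<open>The bound is the same for every truncation level, so it passes to
    \<open>f\<close>.\<close>
  from ext_variance_le_of_clamp[OF f this] False show ?thesis
    by (simp add: diffusion_per_dimension_eq[abs_def])
qed simp

end
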